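(* For all $d\ge2$ and $0\le k\le d-1$, the $d$-dimensional hypercube $Q_d$ satisfies $h^k(Q_d)=1$.
   Context: $Q_d$ is the cubical complex whose $k$-cells are the $d$-tuples over $\{+,-,*\}$ with exactly $k$ entries equal to $*$; the boundary of a cell (over $\mathbb{Z}_2$) is the sum of the cells obtained by replacing one $*$ by $+$ or by $-$. Cochains have $\mathbb{Z}_2$ coefficients (non-reduced, $C^{-1}=0$); $\|\phi\|$ is the number of cells where $\phi$ is nonzero, $\|\phi\|_{csy}=\min_{\psi\in C^{k-1}}\|\phi+d_{k-1}\psi\|$, and $h^k(Q_d)=\min\{\|d_k\phi\|/\|\phi\|_{csy}:\phi\in C^k(Q_d)\setminus B^k(Q_d)\}$ with $B^k=d_{k-1}C^{k-1}$.
   Formalization: With C^{-1}=0 the claim fails at k=0 (the constant cochain 1 is a cocycle outside B^0, so h^0=0); h^k(Q_d)=1 is proved as stated for 1≤k≤d−1, and for all 0≤k≤d−1 with the reduced (augmented) complex, where C^{-1}=Z_2. *)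

theory Defs
  imports Complex_Main "HOL-Library.Z2"
begin

section \<open>Coboundary expansion of a complex over the field with two elements\<close>

text \<open>
  A complex is given by its cells \<open>X k\<close> in each degree \<open>k\<close> and by the support \<open>F c\<close> of the
  boundary of each cell \<open>c\<close>.  Degrees are integers, so that degree \<open>-1\<close> is available.
\<close>

definition cochains :: "(int \<Rightarrow> 'c set) \<Rightarrow> int \<Rightarrow> ('c \<Rightarrow> bit) set" where
  "cochains X k = {\<phi>. \<forall>c. c \<notin> X k \<longrightarrow> \<phi> c = 0}"

text \<open>
  No degree is needed here: on a cochain of degree \<open>k\<close> the result vanishes outside \<open>X (k + 1)\<close>
  when the faces of cells outside \<open>X (k + 1)\<close> lie outside \<open>X k\<close>.
\<close>

definition coboundary :: "('c \<Rightarrow> 'c set) \<Rightarrow> ('c \<Rightarrow> bit) \<Rightarrow> 'c \<Rightarrow> bit" where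
  "coboundary F \<phi> = (\<lambda>c. \<Sum>b\<in>F c. \<phi> b)"

definition coboundaries :: "(int \<Rightarrow> 'c set) \<Rightarrow> ('c \<Rightarrow> 'c set) \<Rightarrow> int \<Rightarrow> ('c \<Rightarrow> bit) set" where
  "coboundaries X F k = coboundary F ` cochains X (k - 1)"

definition weight :: "('c \<Rightarrow> bit) \<Rightarrow> nat" where
  "weight \<phi> = card {c. \<phi> c \<noteq> 0}"

definition csy_norm :: "(int \<Rightarrow> 'c set) \<Rightarrow> ('c \<Rightarrow> 'c set) \<Rightarrow> int \<Rightarrow> ('c \<Rightarrow> bit) \<Rightarrow> nat" where
  "csy_norm X F k \<phi> =
     Min ((\<lambda>\<psi>. weight (\<lambda>c. \<phi> c + coboundary F \<psi> c)) ` cochains X (k - 1))"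

definition cheeger :: "(int \<Rightarrow> 'c set) \<Rightarrow> ('c \<Rightarrow> 'c set) \<Rightarrow> int \<Rightarrow> real" where
  "cheeger X F k =
     Min ((\<lambda>\<phi>. real (weight (coboundary F \<phi>)) / real (csy_norm X F k \<phi>)) `
          (cochains X k - coboundaries X F k))"

text \<open>The augmented complex: a single cell \<open>None\<close> of degree \<open>-1\<close>, a face of every vertex.\<close>

definition aug_cells :: "(int \<Rightarrow> 'c set) \<Rightarrow> int \<Rightarrow> 'c option set" where
  "aug_cells X k = (if k = -1 then {None} else Some ` X k)"

definition aug_faces ::
    "(int \<Rightarrow> 'c set) \<Rightarrow> ('c \<Rightarrow> 'c set) \<Rightarrow> 'c option \<Rightarrow> 'c option set" where
  "aug_faces X F x =
     (case x of None \<Rightarrow> {} | Some c \<Rightarrow> Some ` F c \<union> (if c \<in> X 0 then {None} else {}))"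


section \<open>The cubical complex of the hypercube\<close>

datatype entry = Plus | Minus | Star

definition cube_cells :: "nat \<Rightarrow> int \<Rightarrow> entry list set" where
  "cube_cells d k = {c. length c = d \<and> int (count_list c Star) = k}"

definition cube_faces :: "entry list \<Rightarrow> entry list set" where
  "cube_faces c = {c[i := s] | i s. i < length c \<and> c ! i = Star \<and> s \<in> {Plus, Minus}}"

abbreviation h :: "nat \<Rightarrow> nat \<Rightarrow> real" where
  "h d k \<equiv> cheeger (cube_cells d) cube_faces (int k)"

text \<open>Differs from \<^term>\<open>h\<close> only in that the space of cochains of degree \<open>-1\<close> is that of
  constants, rather than 0.\<close>

abbreviation reduced_h :: "nat \<Rightarrow> nat \<Rightarrow> real" where
  "reduced_h d k \<equiv>
     cheeger (aug_cells (cube_cells d)) (aug_faces (cube_cells d) cube_faces) (int k)"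

text \<open>
  In degree 0 the non-reduced constant vanishes: the constant cochain 1 is a cocycle, but not a
  coboundary.  This is why the value 1 in degree 0 requires \<^term>\<open>reduced_h\<close>.
\<close>

lemma finite_cube_cells: "finite (cube_cells d k)"
proof -
  have "finite {c :: entry list. set c \<subseteq> {Plus, Minus, Star} \<and> length c = d}"
    by (intro finite_lists_length_eq) simp
  moreover have "set c \<subseteq> {Plus, Minus, Star}" for c
  proof
    fix x show "x \<in> {Plus, Minus, Star}" by (cases x) simp_all
  qed
  ultimately have "finite {c :: entry list. length c = d}" by simp
  then show ?thesis by (rule rev_finite_subset) (auto simp: cube_cells_def)
qed

lemma finite_cochains:
  assumes "finite (X k)"
  shows "finite (cochains X k)"
proof -
  have "cochains X k \<subseteq> (\<lambda>S c. if c \<in> S then 1 else 0) ` Pow (X k)"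
  proof
    fix \<phi> assume p: "\<phi> \<in> cochains X k"
    have "\<phi> = (\<lambda>c. if c \<in> {c. \<phi> c \<noteq> 0} then 1 else 0)"
      by (auto simp: fun_eq_iff)
    moreover have "{c. \<phi> c \<noteq> 0} \<in> Pow (X k)" using p by (auto simp: cochains_def)
    ultimately show "\<phi> \<in> (\<lambda>S c. if c \<in> S then 1 else 0) ` Pow (X k)" by blast
  qed
  then show ?thesis using assms by (meson finite_Pow_iff finite_imageI finite_subset)
qed

lemma count_list_update_Star:
  "i < length c \<Longrightarrow> c ! i = Star \<Longrightarrow> s \<noteq> Star \<Longrightarrow>
     Suc (count_list (c[i := s]) Star) = count_list c Star"
  by (induction c arbitrary: i) (auto simp: nth_Cons split: nat.splits)

lemma non_reduced_h_0: "h d 0 = 0"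
proof -
  let ?one = "\<lambda>c. if c \<in> cube_cells d 0 then 1 else (0 :: bit)"
  have one: "?one \<in> cochains (cube_cells d) 0" by (simp add: cochains_def)
  have cm1: "cochains (cube_cells d) (-1) = {\<lambda>c. 0}"
    by (auto simp: cochains_def cube_cells_def)
  have B: "coboundaries (cube_cells d) cube_faces 0 = {\<lambda>c. 0}"
    by (simp add: coboundaries_def cm1 coboundary_def)
  have "replicate d Plus \<in> cube_cells d 0"
    by (simp add: cube_cells_def count_list_0_iff)
  then have "?one (replicate d Plus) \<noteq> 0" by simp
  then have "?one \<noteq> (\<lambda>c. 0)" by (rule contrapos_nn) (rule fun_cong)
  then have nB: "?one \<notin> coboundaries (cube_cells d) cube_faces 0"
    unfolding B by simp
  have "coboundary cube_faces ?one c = 0" for c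
  proof (cases "cube_faces c \<inter> cube_cells d 0 = {}")
    case True
    then show ?thesis unfolding coboundary_def by (intro sum.neutral) auto
  next
    case False
    then obtain i s where ist: "i < length c" "c ! i = Star" "s \<in> {Plus, Minus}"
        "c[i := s] \<in> cube_cells d 0"
      by (auto simp: cube_faces_def)
    have len: "length c = d" using ist(4) by (simp add: cube_cells_def)
    have c1: "count_list c Star = 1"
      using ist count_list_update_Star[of i c s] by (auto simp: cube_cells_def)
    have uniq: "j = i" if j: "j < length c" "c ! j = Star" for j
    proof (rule ccontr)
      assume "j \<noteq> i"
      then have "c[i := s] ! j = Star" "j < length (c[i := s])" using j by simp_all
      then have "Star \<in> set (c[i := s])" by (metis nth_mem)
      then show False using ist(4) by (simp add: cube_cells_def count_list_0_iff)
    qed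
    have F: "cube_faces c = {c[i := Plus], c[i := Minus]}"
      unfolding cube_faces_def using ist(1,2) by (blast dest: uniq)
    have v: "c[i := t] \<in> cube_cells d 0" if "t \<noteq> Star" for t
      using count_list_update_Star[OF ist(1,2) that] c1 len by (simp add: cube_cells_def)
    have "c[i := Plus] ! i \<noteq> c[i := Minus] ! i" using ist(1) by simp
    then have "c[i := Plus] \<noteq> c[i := Minus]" by fastforce
    then show ?thesis by (simp add: coboundary_def F v)
  qed
  then have "weight (coboundary cube_faces ?one) = 0" by (simp add: weight_def)
  then have "0 \<in> (\<lambda>\<phi>. real (weight (coboundary cube_faces \<phi>)) /
      real (csy_norm (cube_cells d) cube_faces 0 \<phi>)) `
      (cochains (cube_cells d) 0 - coboundaries (cube_cells d) cube_faces 0)"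
    using one nB by (intro image_eqI[where x = ?one]) auto
  then show ?thesis
    unfolding cheeger_def of_nat_0
    by (intro Min_eqI finite_imageI finite_Diff finite_cochains finite_cube_cells) auto
qed

end

theory Submission
  imports Defs
begin

text \<open>
  The inequality \<open>\<ge>\<close> is a filling statement, proved by induction on the dimension.  Write a
  cochain of \<open>Q\<^bsub>n+1\<^esub> = Q\<^bsub>n\<^esub> \<times> [-,+]\<close> as \<open>(\<phi>\<^sub>+, \<phi>\<^sub>-, \<phi>\<^sub>*)\<close>.  Adding the coboundary
  of \<open>(\<phi>\<^sub>*, 0, 0)\<close> makes \<open>\<phi>\<^sub>*\<close> vanish, and then \<open>\<parallel>d\<phi>\<parallel> = \<parallel>d\<phi>\<^sub>+\<parallel> + \<parallel>d\<phi>\<^sub>-\<parallel> + \<parallel>\<phi>\<^sub>+ + \<phi>\<^sub>-\<parallel>\<close>.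
  If, say, \<open>\<parallel>d\<phi>\<^sub>+\<parallel> \<le> \<parallel>d\<phi>\<^sub>-\<parallel>\<close>, choose \<open>\<psi>\<close> with \<open>\<parallel>\<phi>\<^sub>+ + d\<psi>\<parallel> \<le> \<parallel>d\<phi>\<^sub>+\<parallel>\<close> and subtract
  the coboundary of \<open>(\<psi>, \<psi>, 0)\<close>; the result has weight at most
  \<open>2 \<parallel>\<phi>\<^sub>+ + d\<psi>\<parallel> + \<parallel>\<phi>\<^sub>+ + \<phi>\<^sub>-\<parallel> \<le> \<parallel>d\<phi>\<parallel>\<close>.

  Equality is attained by the cells \<open>(+, *, \<dots>, *, v)\<close> with \<open>v\<close> ranging over the vertices of
  \<open>Q\<^bsub>d-k-1\<^esub>\<close>.  The coboundary consists of the cells \<open>(*, *, \<dots>, *, v)\<close>, and a cochain with that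
  coboundary must contain a face of each of these, for which \<open>v\<close> can be read off.
\<close>

section \<open>Cochains of a general complex\<close>

lemma bit_add_self [simp]: "x + x = (0 :: bit)"
  by (cases x) simp_all

lemma bit_add_left_self [simp]: "x + (x + y) = (y :: bit)"
  by (cases x; cases y) simp_all

text \<open>Otherwise the simplifier turns addition in the field into Boolean connectives.\<close>

declare add_bit_eq_xor [simp del] bit_not_zero_iff [simp del]

lemma coboundary_add:
  "coboundary F (\<lambda>c. \<phi> c + \<psi> c) = (\<lambda>c. coboundary F \<phi> c + coboundary F \<psi> c)"
  by (simp add: coboundary_def sum.distrib)

lemma coboundary_zero [simp]: "coboundary F (\<lambda>c. 0) = (\<lambda>c. 0)"
  by (simp add: coboundary_def)

lemma cochains_add:
  "\<phi> \<in> cochains X k \<Longrightarrow> \<psi> \<in> cochains X k \<Longrightarrow> (\<lambda>c. \<phi> c + \<psi> c) \<in> cochains X k"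
  by (simp add: cochains_def)

lemma finite_support:
  "\<phi> \<in> cochains X k \<Longrightarrow> finite (X k) \<Longrightarrow> finite {c. \<phi> c \<noteq> 0}"
  by (rule finite_subset[of _ "X k"]) (auto simp: cochains_def)

lemma weight_zero [simp]: "weight (\<lambda>c. 0) = 0"
  by (simp add: weight_def)

lemma weight_add_le:
  assumes "finite {c. \<phi> c \<noteq> 0}" and "finite {c. \<psi> c \<noteq> 0}"
  shows "weight (\<lambda>c. \<phi> c + \<psi> c) \<le> weight \<phi> + weight \<psi>"
proof -
  have "weight (\<lambda>c. \<phi> c + \<psi> c) \<le> card ({c. \<phi> c \<noteq> 0} \<union> {c. \<psi> c \<noteq> 0})"
    unfolding weight_def by (rule card_mono) (use assms in auto)
  also have "\<dots> \<le> weight \<phi> + weight \<psi>"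
    unfolding weight_def by (rule card_Un_le)
  finally show ?thesis .
qed

text \<open>\<open>fill\<close> makes every ratio at least 1 and leaves no cocycles besides
  coboundaries; \<open>sharp\<close> gives the reverse bound on the norm of \<open>\<phi>0\<close>,
  whose ratio is therefore 1.\<close>

lemma cheeger_eq_1:
  assumes fin: "finite (X k)" "finite (X (k - 1))"
    and closed: "\<And>\<psi>. \<psi> \<in> cochains X (k - 1) \<Longrightarrow> coboundary F \<psi> \<in> cochains X k"
    and fill: "\<And>\<phi>. \<phi> \<in> cochains X k \<Longrightarrow>
      \<exists>\<psi>\<in>cochains X (k - 1). weight (\<lambda>c. \<phi> c + coboundary F \<psi> c) \<le> weight (coboundary F \<phi>)"
    and sharp: "\<phi>0 \<in> cochains X k" "0 < weight (coboundary F \<phi>0)"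
      "\<And>\<psi>. \<psi> \<in> cochains X (k - 1) \<Longrightarrow>
        weight (coboundary F \<phi>0) \<le> weight (\<lambda>c. \<phi>0 c + coboundary F \<psi> c)"
  shows "cheeger X F k = 1"
proof -
  let ?W = "\<lambda>\<phi>. (\<lambda>\<psi>. weight (\<lambda>c. \<phi> c + coboundary F \<psi> c)) ` cochains X (k - 1)"
  have finW: "finite (?W \<phi>)" for \<phi>
    by (intro finite_imageI finite_cochains fin)
  have neW: "?W \<phi> \<noteq> {}" for \<phi>
    by (auto simp: cochains_def)
  have le: "csy_norm X F k \<phi> \<le> weight (coboundary F \<phi>)" if "\<phi> \<in> cochains X k" for \<phi>
    unfolding csy_norm_def using fill[OF that] finW[of \<phi>] neW[of \<phi>]
    by (subst Min_le_iff) auto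
  have pos: "0 < csy_norm X F k \<phi>"
    if "\<phi> \<in> cochains X k" "\<phi> \<notin> coboundaries X F k" for \<phi>
  proof -
    have "0 < weight (\<lambda>c. \<phi> c + coboundary F \<psi> c)" if psi: "\<psi> \<in> cochains X (k - 1)" for \<psi>
    proof (rule ccontr)
      have "finite {c. \<phi> c + coboundary F \<psi> c \<noteq> 0}"
        using cochains_add[OF \<open>\<phi> \<in> cochains X k\<close> closed[OF psi]] fin(1) by (rule finite_support)
      moreover assume "\<not> ?thesis"
      ultimately have "\<phi> c + coboundary F \<psi> c = 0" for c
        by (simp add: weight_def)
      then have "\<phi> = coboundary F \<psi>"
        by (metis add.right_neutral bit_add_left_self ext add.commute)
      with psi \<open>\<phi> \<notin> coboundaries X F k\<close> show False
        by (auto simp: coboundaries_def)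
    qed
    then show ?thesis
      unfolding csy_norm_def using finW[of \<phi>] neW[of \<phi>] by (subst Min_gr_iff) auto
  qed
  \<comment> \<open>Adding its own coboundary expression to \<open>\<phi>0\<close> would give weight
    0, against the positivity in \<open>sharp\<close>.\<close>
  have nB: "\<phi>0 \<notin> coboundaries X F k"
  proof
    assume "\<phi>0 \<in> coboundaries X F k"
    then obtain \<psi> where "\<psi> \<in> cochains X (k - 1)" "\<phi>0 = coboundary F \<psi>"
      by (auto simp: coboundaries_def)
    with sharp(2) sharp(3)[of \<psi>] show False by simp
  qed
  have "weight (coboundary F \<phi>0) \<le> csy_norm X F k \<phi>0"
    unfolding csy_norm_def using sharp(3) finW[of \<phi>0] neW[of \<phi>0] by (subst Min_ge_iff) auto
  with le[OF sharp(1)] have eq: "csy_norm X F k \<phi>0 = weight (coboundary F \<phi>0)" by simp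
  show ?thesis
    unfolding cheeger_def
  proof (rule Min_eqI)
    show "finite ((\<lambda>\<phi>. real (weight (coboundary F \<phi>)) / real (csy_norm X F k \<phi>)) `
        (cochains X k - coboundaries X F k))"
      by (intro finite_imageI finite_Diff finite_cochains fin)
    show "1 \<in> (\<lambda>\<phi>. real (weight (coboundary F \<phi>)) / real (csy_norm X F k \<phi>)) `
        (cochains X k - coboundaries X F k)"
      using sharp nB eq by (intro image_eqI[of _ _ \<phi>0]) auto
  qed (use le pos in \<open>auto simp: le_divide_eq\<close>)
qed


section \<open>The coboundary operator of the hypercube\<close>

lemma cube_faces_Nil [simp]: "cube_faces [] = {}"
  by (simp add: cube_faces_def)

lemma cube_faces_Cons:
  "cube_faces (x # c) =
    Cons x ` cube_faces c \<union> (if x = Star then {Plus # c, Minus # c} else {})" (is "?L = ?R")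
proof
  show "?L \<subseteq> ?R"
  proof
    fix b assume "b \<in> ?L"
    then obtain i s where b: "i < length (x # c)" "(x # c) ! i = Star" "s \<in> {Plus, Minus}"
        "b = (x # c)[i := s]"
      by (auto simp: cube_faces_def)
    show "b \<in> ?R"
    proof (cases i)
      case (Suc j)
      with b have "c[j := s] \<in> cube_faces c" by (auto simp: cube_faces_def)
      with b Suc show ?thesis by auto
    qed (use b in auto)
  qed
  have "Cons x ` cube_faces c \<subseteq> ?L"
  proof
    fix b assume "b \<in> Cons x ` cube_faces c"
    then obtain i s where "i < length c" "c ! i = Star" "s \<in> {Plus, Minus}" "b = x # c[i := s]"
      by (auto simp: cube_faces_def)
    then show "b \<in> ?L"
      unfolding cube_faces_def by (intro CollectI exI[of _ "Suc i"] exI[of _ s]) auto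
  qed
  moreover have "(if x = Star then {Plus # c, Minus # c} else {}) \<subseteq> ?L"
    unfolding cube_faces_def by (auto intro!: exI[of _ 0])
  ultimately show "?R \<subseteq> ?L" by simp
qed

lemma finite_cube_faces [simp]: "finite (cube_faces c)"
  by (induction c) (auto simp: cube_faces_Cons)

lemma coboundary_Nil [simp]: "coboundary cube_faces \<phi> [] = 0"
  by (simp add: coboundary_def)

text \<open>This is the product formula for an interval times a cube: the new direction contributes
  only the sum of the two ends. The inductions below peel off the first coordinate through
  it.\<close>

lemma coboundary_Cons:
  "coboundary cube_faces \<phi> (x # c) = coboundary cube_faces (\<lambda>b. \<phi> (x # b)) c +
    (if x = Star then \<phi> (Plus # c) + \<phi> (Minus # c) else 0)"
proof -
  have "(\<Sum>b\<in>Cons x ` cube_faces c. \<phi> b) = (\<Sum>b\<in>cube_faces c. \<phi> (x # b))"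
    by (subst sum.reindex) auto
  then show ?thesis
    unfolding coboundary_def cube_faces_Cons
    by (subst sum.union_disjoint) auto
qed

text \<open>On a cell with head \<open>Star\<close>, the coboundaries of the two end slices arise
  twice, once through the \<open>Star\<close> slice and once through the ends, and cancel mod
  2.\<close>

lemma coboundary_coboundary:
  "coboundary cube_faces (coboundary cube_faces \<phi>) = (\<lambda>c. 0)"
proof
  show "coboundary cube_faces (coboundary cube_faces \<phi>) c = 0" for c
    by (induction c arbitrary: \<phi>)
      (auto simp: coboundary_Cons coboundary_add)
qed

lemma Nil_in_cube_cells: "[] \<in> cube_cells n k \<longleftrightarrow> n = 0 \<and> k = 0"
  by (auto simp: cube_cells_def)

lemma Cons_in_cube_cells:
  "x # c \<in> cube_cells (Suc n) k \<longleftrightarrow> c \<in> cube_cells n (if x = Star then k - 1 else k)"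
  by (auto simp: cube_cells_def)

lemma cube_cells_neg [simp]: "k < 0 \<Longrightarrow> cube_cells n k = {}"
  by (auto simp: cube_cells_def)

lemma cube_faces_in_cube_cells:
  "b \<in> cube_faces c \<Longrightarrow> b \<in> cube_cells n k \<longleftrightarrow> c \<in> cube_cells n (k + 1)"
  using count_list_update_Star by (fastforce simp: cube_faces_def cube_cells_def)

lemma coboundary_in_cochains:
  assumes "\<phi> \<in> cochains (cube_cells n) k"
  shows "coboundary cube_faces \<phi> \<in> cochains (cube_cells n) (k + 1)"
  using assms cube_faces_in_cube_cells[of _ _ n k]
  by (fastforce simp: cochains_def coboundary_def intro: sum.neutral)

lemma cochains_slice:
  "\<phi> \<in> cochains (cube_cells (Suc n)) k \<Longrightarrow>
    (\<lambda>c. \<phi> (x # c)) \<in> cochains (cube_cells n) (if x = Star then k - 1 else k)"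
  by (simp add: cochains_def Cons_in_cube_cells)

lemma weight_slices:
  assumes "\<phi> \<in> cochains (cube_cells (Suc n)) k"
  shows "weight \<phi> = weight (\<lambda>c. \<phi> (Plus # c)) + weight (\<lambda>c. \<phi> (Minus # c)) +
    weight (\<lambda>c. \<phi> (Star # c))"
proof -
  let ?S = "\<lambda>x. {c. \<phi> (x # c) \<noteq> 0}"
  have fin: "finite (?S x)" for x
    using finite_support[OF cochains_slice[OF assms, of x] finite_cube_cells] .
  have card: "card (Cons x ` ?S x) = weight (\<lambda>c. \<phi> (x # c))" for x
    unfolding weight_def by (rule card_image) auto
  have nil: "\<phi> [] = 0"
    using assms by (simp add: cochains_def Nil_in_cube_cells)
  have "c \<in> Cons Plus ` ?S Plus \<union> Cons Minus ` ?S Minus \<union> Cons Star ` ?S Star"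
    if "\<phi> c \<noteq> 0" for c
  proof (cases c)
    case (Cons x b)
    with that show ?thesis by (cases x) auto
  qed (use that nil in simp)
  then have "{c. \<phi> c \<noteq> 0} =
      Cons Plus ` ?S Plus \<union> Cons Minus ` ?S Minus \<union> Cons Star ` ?S Star"
    by auto
  then have "weight \<phi> =
      card (Cons Plus ` ?S Plus \<union> Cons Minus ` ?S Minus \<union> Cons Star ` ?S Star)"
    by (simp add: weight_def)
  also have "\<dots> = card (Cons Plus ` ?S Plus) + card (Cons Minus ` ?S Minus) +
      card (Cons Star ` ?S Star)"
    by (subst card_Un_disjoint; (subst card_Un_disjoint)?) (use fin in auto)
  finally show ?thesis by (simp add: card)
qed


section \<open>The sharp example\<close>

definition strip :: "nat \<Rightarrow> nat \<Rightarrow> entry list \<Rightarrow> bit" where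
  "strip n k c = (if length c = n \<and> take k c = replicate k Star \<and> Star \<notin> set (drop k c)
    then 1 else 0)"

text \<open>The case \<open>k = 0\<close> is the all-ones cochain on vertices, that is, the
  coboundary of the augmenting cell. Closedness of strips therefore also covers the augmented
  term.\<close>

lemma strip_0: "strip n 0 c = (if c \<in> cube_cells n 0 then 1 else 0)"
  by (auto simp: strip_def cube_cells_def count_list_0_iff)

lemma strip_0_Cons: "strip n 0 (x # c) = (if x \<noteq> Star \<and> n \<noteq> 0 then strip (n - 1) 0 c else 0)"
  by (auto simp: strip_def)

lemma strip_Suc_Cons:
  "strip n (Suc k) (x # c) = (if x = Star \<and> n \<noteq> 0 then strip (n - 1) k c else 0)"
  by (auto simp: strip_def)

lemma coboundary_strip_0: "coboundary cube_faces (strip n 0) c = 0"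
proof (induction c arbitrary: n)
  case (Cons x c)
  then show ?case by (cases n) (auto simp: coboundary_Cons strip_0_Cons)
qed simp

text \<open>Peeling off leading stars reduces to \<open>k = 0\<close>, where the two ends of an edge
  cancel.\<close>

lemma coboundary_strip: "coboundary cube_faces (strip n k) c = 0"
proof (induction c arbitrary: n k)
  case (Cons x c)
  show ?case
  proof (cases k)
    case 0
    then show ?thesis by (simp only: coboundary_strip_0)
  next
    case (Suc j)
    with Cons show ?thesis by (cases n) (auto simp: coboundary_Cons strip_Suc_Cons)
  qed
qed simp

lemma count_list_replicate_same: "count_list (replicate k x) x = k"
  by (induction k) auto

lemma strip_in_cochains: "k \<le> n \<Longrightarrow> strip n k \<in> cochains (cube_cells n) (int k)"
proof -
  have "int (count_list c Star) = int k"
    if "take k c = replicate k Star" "Star \<notin> set (drop k c)" for c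
  proof -
    have "count_list (take k c @ drop k c) Star = k"
      using that by (simp only: count_list_append)
        (simp add: count_list_0_iff count_list_replicate_same)
    then show ?thesis by simp
  qed
  then show ?thesis by (auto simp: cochains_def cube_cells_def strip_def)
qed

definition half_strip :: "nat \<Rightarrow> nat \<Rightarrow> entry list \<Rightarrow> bit" where
  "half_strip n k c = (case c of Plus # b \<Rightarrow> strip n k b | _ \<Rightarrow> 0)"

lemma half_strip_in_cochains:
  "k \<le> n \<Longrightarrow> half_strip n k \<in> cochains (cube_cells (Suc n)) (int k)"
  using strip_in_cochains[of k n]
  by (auto simp: cochains_def half_strip_def Cons_in_cube_cells split: list.splits entry.splits)

text \<open>Inside the \<open>Plus\<close> end the strip is closed, so only cells with head
  \<open>Star\<close> survive, each through its \<open>Plus\<close> end alone.\<close>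

lemma coboundary_half_strip:
  "coboundary cube_faces (half_strip n k) = strip (Suc n) (Suc k)"
proof
  show "coboundary cube_faces (half_strip n k) c = strip (Suc n) (Suc k) c" for c
  proof (cases c)
    case Nil
    then show ?thesis by (simp add: strip_def)
  next
    case (Cons x b)
    then show ?thesis
      by (cases x)
        (simp_all add: coboundary_Cons half_strip_def strip_Suc_Cons coboundary_strip)
  qed
qed

lemma weight_strip_pos: "k \<le> n \<Longrightarrow> 0 < weight (strip n k)"
proof -
  assume k: "k \<le> n"
  then have "strip n k (replicate k Star @ replicate (n - k) Plus) \<noteq> 0"
    by (simp add: strip_def)
  then show ?thesis
    using finite_support[OF strip_in_cochains[OF k] finite_cube_cells]
    by (auto simp: weight_def card_gt_0_iff)
qed

text \<open>Each cell of the strip has a face in the support of \<open>\<chi>\<close>, and resetting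
  the first \<open>j\<close> entries of that face to \<open>Star\<close> recovers the cell. So the
  support of \<open>\<chi>\<close> maps onto a set containing the strip.\<close>

lemma weight_strip_le:
  assumes chi: "\<chi> \<in> cochains (cube_cells n) k"
    and cob: "coboundary cube_faces \<chi> = strip n j"
  shows "weight (strip n j) \<le> weight \<chi>"
proof -
  have "{c. strip n j c \<noteq> 0} \<subseteq> (\<lambda>b. replicate j Star @ drop j b) ` {b. \<chi> b \<noteq> 0}"
  proof
    fix c assume "c \<in> {c. strip n j c \<noteq> 0}"
    then have c: "strip n j c \<noteq> 0" by simp
    then have tk: "take j c = replicate j Star" and dr: "Star \<notin> set (drop j c)"
      by (auto simp: strip_def split: if_splits)
    from c have "(\<Sum>b\<in>cube_faces c. \<chi> b) \<noteq> 0"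
      using fun_cong[OF cob, of c] by (simp add: coboundary_def)
    then obtain b where b: "b \<in> cube_faces c" "\<chi> b \<noteq> 0"
      by (meson sum.neutral)
    then obtain i s where i: "i < length c" "c ! i = Star" "b = c[i := s]"
      by (auto simp: cube_faces_def)
    \<comment> \<open>The replaced entry was a star, and the tail of \<open>c\<close> beyond
      position \<open>j\<close> has none.\<close>
    have "i < j"
    proof (rule ccontr)
      assume "\<not> i < j"
      then have "drop j c ! (i - j) = Star" "i - j < length (drop j c)"
        using i by auto
      with dr show False by (metis nth_mem)
    qed
    then have "drop j b = drop j c" using i by simp
    then have "c = replicate j Star @ drop j b" using tk by (metis append_take_drop_id)
    with b show "c \<in> (\<lambda>b. replicate j Star @ drop j b) ` {b. \<chi> b \<noteq> 0}" by auto
  qed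
  then show ?thesis
    unfolding weight_def by (rule surj_card_le[OF finite_support[OF chi finite_cube_cells]])
qed


section \<open>The filling inequality\<close>

text \<open>The constant \<open>a\<close> is the cochain of degree \<open>-1\<close> in the augmented complex.\<close>

definition aug_coboundary ::
    "nat \<Rightarrow> (entry list \<Rightarrow> bit) \<Rightarrow> bit \<Rightarrow> entry list \<Rightarrow> bit" where
  "aug_coboundary n \<psi> a c =
    coboundary cube_faces \<psi> c + (if c \<in> cube_cells n 0 then a else 0)"

text \<open>The constant term is either 0 or \<open>strip n 0\<close>, which is closed.\<close>

lemma coboundary_aug_coboundary:
  "coboundary cube_faces (aug_coboundary n \<psi> a) = (\<lambda>c. 0)"
proof -
  have "aug_coboundary n \<psi> a =
      (\<lambda>c. coboundary cube_faces \<psi> c + (if a = 0 then 0 else strip n 0 c))"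
    by (cases a) (auto simp: aug_coboundary_def strip_0 fun_eq_iff)
  then show ?thesis
    by (cases a) (simp_all add: coboundary_add coboundary_coboundary coboundary_strip)
qed

lemma aug_coboundary_in_cochains:
  assumes "\<psi> \<in> cochains (cube_cells n) (k - 1)" and "0 < k \<Longrightarrow> a = 0" and "0 \<le> k"
  shows "aug_coboundary n \<psi> a \<in> cochains (cube_cells n) k"
proof (cases "k = 0")
  case True
  then show ?thesis
    using coboundary_in_cochains[OF assms(1)]
    by (auto simp: aug_coboundary_def cochains_def)
next
  case False
  then show ?thesis
    using coboundary_in_cochains[OF assms(1)] assms
    by (simp add: aug_coboundary_def cochains_def)
qed

lemma cylinder_filling:
  assumes k: "0 \<le> k"
    and IH: "\<And>\<phi>. \<phi> \<in> cochains (cube_cells n) k \<Longrightarrow>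
      \<exists>\<psi>\<in>cochains (cube_cells n) (k - 1). \<exists>a. (0 < k \<longrightarrow> a = 0) \<and>
        weight (\<lambda>c. \<phi> c + aug_coboundary n \<psi> a c) \<le> weight (coboundary cube_faces \<phi>)"
    and phi: "\<phi> \<in> cochains (cube_cells (Suc n)) k"
    and star: "\<And>c. \<phi> (Star # c) = 0"
  shows "\<exists>\<psi>\<in>cochains (cube_cells (Suc n)) (k - 1). \<exists>a. (0 < k \<longrightarrow> a = 0) \<and>
    weight (\<lambda>c. \<phi> c + aug_coboundary (Suc n) \<psi> a c) \<le> weight (coboundary cube_faces \<phi>)"
proof -
  let ?d = "coboundary cube_faces"
  let ?s = "\<lambda>x c. \<phi> (x # c)"
  have s: "?s x \<in> cochains (cube_cells n) k" if "x \<noteq> Star" for x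
    using cochains_slice[OF phi, of x] that by simp
  \<comment> \<open>Here \<open>x\<close> is the end with the lighter coboundary; keeping the pair
    unordered treats both cases at once.\<close>
  obtain x y where xy: "{x, y} = {Plus, Minus}" "weight (?d (?s x)) \<le> weight (?d (?s y))"
    by (metis insert_commute linear)
  then have ns: "x \<noteq> Star" "y \<noteq> Star" by auto
  obtain \<psi> a where psi: "\<psi> \<in> cochains (cube_cells n) (k - 1)" and a: "0 < k \<longrightarrow> a = 0"
    and le: "weight (\<lambda>c. ?s x c + aug_coboundary n \<psi> a c) \<le> weight (?d (?s x))"
    using IH[OF s[OF ns(1)]] by blast
  \<comment> \<open>The filling of the end \<open>x\<close> is copied to both ends, so that it is
    constant along the new direction.\<close>
  define \<psi>' where "\<psi>' c = (case c of [] \<Rightarrow> 0 | z # b \<Rightarrow> if z = Star then 0 else \<psi> b)" for c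
  have psi': "\<psi>' \<in> cochains (cube_cells (Suc n)) (k - 1)"
    using psi by (auto simp: cochains_def \<psi>'_def Cons_in_cube_cells split: list.splits)
  have sl: "\<psi>' (z # b) = (if z = Star then 0 else \<psi> b)" for z b
    by (simp add: \<psi>'_def)
  \<comment> \<open>The two equal copies cancel on cells with head \<open>Star\<close>, so that
    slice stays 0.\<close>
  have aug: "aug_coboundary (Suc n) \<psi>' a (z # b) = (if z = Star then 0 else aug_coboundary n \<psi> a b)"
    for z b
    by (simp add: aug_coboundary_def coboundary_Cons sl Cons_in_cube_cells)
  let ?\<chi> = "\<lambda>z c. ?s z c + aug_coboundary n \<psi> a c"
  have aug_in: "aug_coboundary n \<psi> a \<in> cochains (cube_cells n) k"
    by (rule aug_coboundary_in_cochains) (use psi a k in auto)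
  have fin: "finite {c. ?\<chi> x c \<noteq> 0}" "finite {c. ?s x c + ?s y c \<noteq> 0}"
    using finite_support[OF cochains_add[OF s[OF ns(1)] aug_in] finite_cube_cells]
      finite_support[OF cochains_add[OF s[OF ns(1)] s[OF ns(2)]] finite_cube_cells] .
  \<comment> \<open>The end \<open>y\<close> is corrected by the filling chosen for
    \<open>x\<close>; what is left exceeds the remainder at \<open>x\<close> by at most the
    difference of the ends.\<close>
  have "weight (?\<chi> y) = weight (\<lambda>c. ?\<chi> x c + (?s x c + ?s y c))"
    by (rule arg_cong[of _ _ weight]) (auto simp: ac_simps)
  also have "\<dots> \<le> weight (?\<chi> x) + weight (\<lambda>c. ?s x c + ?s y c)"
    by (rule weight_add_le[OF fin])
  finally have y: "weight (?\<chi> y) \<le> weight (?\<chi> x) + weight (\<lambda>c. ?s x c + ?s y c)" .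
  have "(\<lambda>c. \<phi> c + aug_coboundary (Suc n) \<psi>' a c) \<in> cochains (cube_cells (Suc n)) k"
    by (intro cochains_add phi aug_coboundary_in_cochains psi' k) (use a in auto)
  then have "weight (\<lambda>c. \<phi> c + aug_coboundary (Suc n) \<psi>' a c) =
      weight (?\<chi> Plus) + weight (?\<chi> Minus)"
    by (subst weight_slices) (auto simp: aug star)
  also have "\<dots> = weight (?\<chi> x) + weight (?\<chi> y)"
    using xy(1) by (auto simp: doubleton_eq_iff)
  also have "\<dots> \<le> weight (?d (?s x)) + weight (?d (?s y)) + weight (\<lambda>c. ?s x c + ?s y c)"
    using y le xy(2) by linarith
  also have "\<dots> = weight (?d (?s Plus)) + weight (?d (?s Minus)) +
      weight (\<lambda>c. ?s Plus c + ?s Minus c)"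
    using xy(1) by (auto simp: doubleton_eq_iff add.commute)
  also have "\<dots> = weight (?d \<phi>)"
    by (subst weight_slices[OF coboundary_in_cochains[OF phi]]) (simp add: coboundary_Cons star)
  finally show ?thesis using psi' a by blast
qed

text \<open>The condition on \<open>a\<close> lets one induction serve both complexes: the constant
  is available in degree 0 only, and in positive degree the filling is an ordinary one.\<close>

lemma cube_filling:
  assumes k: "0 \<le> k" and "\<phi> \<in> cochains (cube_cells n) k"
  shows "\<exists>\<psi>\<in>cochains (cube_cells n) (k - 1). \<exists>a. (0 < k \<longrightarrow> a = 0) \<and>
    weight (\<lambda>c. \<phi> c + aug_coboundary n \<psi> a c) \<le> weight (coboundary cube_faces \<phi>)"
  using assms(2)
proof (induction n arbitrary: \<phi>)
  case 0
  have cells: "c \<in> cube_cells 0 j \<longleftrightarrow> c = [] \<and> j = 0" for c j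
    by (auto simp: cube_cells_def)
  \<comment> \<open>On the one-point cube, the constant \<open>\<phi> []\<close> removes
    \<open>\<phi>\<close> altogether.\<close>
  have "\<phi> c + aug_coboundary 0 (\<lambda>c. 0) (\<phi> []) c = 0" for c
    using 0 by (auto simp: aug_coboundary_def cells cochains_def)
  moreover have "0 < k \<longrightarrow> \<phi> [] = 0"
    using 0 by (simp add: cochains_def cells)
  ultimately show ?case
    by (intro bexI[of _ "\<lambda>c. 0"] exI[of _ "\<phi> []"]) (simp_all add: cochains_def)
next
  case (Suc n)
  \<comment> \<open>On a cell with head \<open>Star\<close>, the coboundary of
    \<open>\<psi>0\<close> sees only the \<open>Plus\<close> end, which reproduces
    \<open>\<phi>\<close> there and cancels it.\<close>
  define \<psi>0 where "\<psi>0 c = (case c of Plus # b \<Rightarrow> \<phi> (Star # b) | _ \<Rightarrow> 0)" for c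
  have psi0: "\<psi>0 \<in> cochains (cube_cells (Suc n)) (k - 1)"
    using Suc.prems
    by (auto simp: cochains_def \<psi>0_def Cons_in_cube_cells split: list.splits entry.splits)
  define \<phi>' where "\<phi>' c = \<phi> c + coboundary cube_faces \<psi>0 c" for c
  have phi': "\<phi>' \<in> cochains (cube_cells (Suc n)) k"
    unfolding \<phi>'_def[abs_def]
    by (intro cochains_add Suc.prems) (use coboundary_in_cochains[OF psi0] in simp)
  have star: "\<phi>' (Star # c) = 0" for c
    by (simp add: \<phi>'_def coboundary_Cons \<psi>0_def)
  have cob: "coboundary cube_faces \<phi>' = coboundary cube_faces \<phi>"
    unfolding \<phi>'_def[abs_def] by (simp add: coboundary_add coboundary_coboundary)
  obtain \<psi> a where psi: "\<psi> \<in> cochains (cube_cells (Suc n)) (k - 1)" and a: "0 < k \<longrightarrow> a = 0"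
    and le: "weight (\<lambda>c. \<phi>' c + aug_coboundary (Suc n) \<psi> a c) \<le> weight (coboundary cube_faces \<phi>')"
    using cylinder_filling[OF k Suc.IH phi' star] by blast
  have eq: "\<phi>' c + aug_coboundary (Suc n) \<psi> a c =
      \<phi> c + aug_coboundary (Suc n) (\<lambda>c. \<psi>0 c + \<psi> c) a c" for c
    by (simp add: \<phi>'_def aug_coboundary_def coboundary_add ac_simps)
  show ?case
    using le[unfolded eq cob] a cochains_add[OF psi0 psi] by blast
qed

text \<open>Adding an augmented coboundary leaves the coboundary a strip, so
  \<open>weight_strip_le\<close> applies to every representative of the class.\<close>

lemma half_strip_sharp:
  assumes "k \<le> n" and "\<psi> \<in> cochains (cube_cells (Suc n)) (int k - 1)" and "0 < k \<Longrightarrow> a = 0"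
  shows "weight (coboundary cube_faces (half_strip n k)) \<le>
    weight (\<lambda>c. half_strip n k c + aug_coboundary (Suc n) \<psi> a c)"
  unfolding coboundary_half_strip
proof (rule weight_strip_le)
  show "(\<lambda>c. half_strip n k c + aug_coboundary (Suc n) \<psi> a c)
      \<in> cochains (cube_cells (Suc n)) (int k)"
    by (intro cochains_add half_strip_in_cochains aug_coboundary_in_cochains) (use assms in auto)
  show "coboundary cube_faces (\<lambda>c. half_strip n k c + aug_coboundary (Suc n) \<psi> a c) =
      strip (Suc n) (Suc k)"
    by (simp add: coboundary_add coboundary_half_strip coboundary_aug_coboundary)
qed

lemma aug_coboundary_0: "aug_coboundary n \<psi> 0 = coboundary cube_faces \<psi>"
  by (simp add: aug_coboundary_def fun_eq_iff)

lemma h_eq_1: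
  assumes "1 \<le> k" and "k \<le> n"
  shows "h (Suc n) k = 1"
proof (rule cheeger_eq_1[where ?\<phi>0.0 = "half_strip n k"])
  show "coboundary cube_faces \<psi> \<in> cochains (cube_cells (Suc n)) (int k)"
    if "\<psi> \<in> cochains (cube_cells (Suc n)) (int k - 1)" for \<psi>
    using coboundary_in_cochains[OF that] by simp
  show "\<exists>\<psi>\<in>cochains (cube_cells (Suc n)) (int k - 1).
      weight (\<lambda>c. \<phi> c + coboundary cube_faces \<psi> c) \<le> weight (coboundary cube_faces \<phi>)"
    if "\<phi> \<in> cochains (cube_cells (Suc n)) (int k)" for \<phi>
    using cube_filling[OF _ that] assms by (auto simp: aug_coboundary_0)
  show "weight (coboundary cube_faces (half_strip n k)) \<le>
      weight (\<lambda>c. half_strip n k c + coboundary cube_faces \<psi> c)"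
    if "\<psi> \<in> cochains (cube_cells (Suc n)) (int k - 1)" for \<psi>
    using half_strip_sharp[OF assms(2) that, of 0] by (simp add: aug_coboundary_0)
qed (use assms in \<open>auto simp: finite_cube_cells coboundary_half_strip weight_strip_pos
      half_strip_in_cochains\<close>)


section \<open>The augmented complex\<close>

lemma coboundary_aug_faces_None [simp]: "coboundary (aug_faces X F) \<Psi> None = 0"
  by (simp add: coboundary_def aug_faces_def)

lemma coboundary_aug_faces_Some:
  assumes "finite (F c)"
  shows "coboundary (aug_faces X F) \<Psi> (Some c) =
    coboundary F (\<lambda>b. \<Psi> (Some b)) c + (if c \<in> X 0 then \<Psi> None else 0)"
proof -
  have "(\<Sum>b\<in>Some ` F c. \<Psi> b) = (\<Sum>b\<in>F c. \<Psi> (Some b))"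
    by (subst sum.reindex) auto
  then show ?thesis
    using assms by (auto simp: coboundary_def aug_faces_def sum.union_disjoint)
qed

lemma coboundary_aug_cube_Some:
  "coboundary (aug_faces (cube_cells n) cube_faces) \<Psi> (Some c) =
    aug_coboundary n (\<lambda>b. \<Psi> (Some b)) (\<Psi> None) c"
  by (simp add: coboundary_aug_faces_Some aug_coboundary_def)

text \<open>The assumption makes \<open>None\<close> the only cell of degree -1, so in that degree
  the \<open>Some\<close> part must vanish.\<close>

lemma cochains_aug_cells:
  assumes "X (- 1) = {}"
  shows "\<Phi> \<in> cochains (aug_cells X) k \<longleftrightarrow>
    (\<lambda>c. \<Phi> (Some c)) \<in> cochains X k \<and> (k \<noteq> -1 \<longrightarrow> \<Phi> None = 0)"
proof -
  have "(\<forall>x. P x) \<longleftrightarrow> P None \<and> (\<forall>c. P (Some c))" for P :: "'a option \<Rightarrow> bool"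
    by (metis not_None_eq)
  then show ?thesis
    using assms by (auto simp: cochains_def aug_cells_def)
qed

lemma weight_option:
  assumes "\<Phi> None = 0"
  shows "weight \<Phi> = weight (\<lambda>c. \<Phi> (Some c))"
proof -
  have "x \<in> Some ` {c. \<Phi> (Some c) \<noteq> 0}" if "\<Phi> x \<noteq> 0" for x
    using that assms by (cases x) auto
  then have "{x. \<Phi> x \<noteq> 0} = Some ` {c. \<Phi> (Some c) \<noteq> 0}" by auto
  then show ?thesis by (simp add: weight_def card_image)
qed

text \<open>A cochain of the augmented complex is a pair of an ordinary cochain and its value at
  \<open>None\<close>; under this splitting its coboundary becomes \<open>aug_coboundary\<close>. In
  degree \<open>k\<close> the value at \<open>None\<close> is 0, so weights agree.\<close>

lemma reduced_h_eq_1: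
  assumes kn: "k \<le> n"
  shows "reduced_h (Suc n) k = 1"
proof -
  let ?X = "cube_cells (Suc n)"
  let ?A = "aug_cells ?X"
  let ?d = "coboundary (aug_faces ?X cube_faces)"
  have in_A: "\<Phi> \<in> cochains ?A j \<longleftrightarrow>
      (\<lambda>c. \<Phi> (Some c)) \<in> cochains ?X j \<and> (j \<noteq> -1 \<longrightarrow> \<Phi> None = 0)" for \<Phi> j
    by (rule cochains_aug_cells) simp
  have d_eq: "(\<lambda>c. ?d \<Phi> (Some c)) = coboundary cube_faces (\<lambda>c. \<Phi> (Some c))"
    if "\<Phi> None = 0" for \<Phi>
    using that by (simp add: coboundary_aug_cube_Some aug_coboundary_0)
  have w_d: "weight (?d \<Phi>) = weight (coboundary cube_faces (\<lambda>c. \<Phi> (Some c)))"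
    if "\<Phi> None = 0" for \<Phi>
    by (subst weight_option) (simp_all add: d_eq that)
  have w_add: "weight (\<lambda>x. \<Phi> x + ?d \<Psi> x) =
      weight (\<lambda>c. \<Phi> (Some c) + aug_coboundary (Suc n) (\<lambda>c. \<Psi> (Some c)) (\<Psi> None) c)"
    if "\<Phi> None = 0" for \<Phi> \<Psi>
    by (subst weight_option) (simp_all add: that coboundary_aug_cube_Some)
  have fin: "finite (?A j)" for j
    by (simp add: aug_cells_def finite_cube_cells)
  define \<Phi>0 where "\<Phi>0 x = (case x of None \<Rightarrow> 0 | Some c \<Rightarrow> half_strip n k c)" for x
  have Phi0 [simp]: "\<Phi>0 None = 0" "\<Phi>0 (Some c) = half_strip n k c" for c
    by (simp_all add: \<Phi>0_def)
  show ?thesis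
  proof (rule cheeger_eq_1[where ?\<phi>0.0 = \<Phi>0])
    show "?d \<Psi> \<in> cochains ?A (int k)" if "\<Psi> \<in> cochains ?A (int k - 1)" for \<Psi>
      using that unfolding in_A
      by (auto simp: coboundary_aug_cube_Some intro: aug_coboundary_in_cochains)
    show "\<exists>\<Psi>\<in>cochains ?A (int k - 1). weight (\<lambda>x. \<Phi> x + ?d \<Psi> x) \<le> weight (?d \<Phi>)"
      if "\<Phi> \<in> cochains ?A (int k)" for \<Phi>
    proof -
      have Phi: "(\<lambda>c. \<Phi> (Some c)) \<in> cochains ?X (int k)" "\<Phi> None = 0"
        using that by (simp_all add: in_A)
      obtain \<psi> a where psi: "\<psi> \<in> cochains ?X (int k - 1)" "0 < int k \<longrightarrow> a = 0"
        and le: "weight (\<lambda>c. \<Phi> (Some c) + aug_coboundary (Suc n) \<psi> a c) \<le>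
          weight (coboundary cube_faces (\<lambda>c. \<Phi> (Some c)))"
        using cube_filling[OF _ Phi(1)] by auto
      show ?thesis
        \<comment> \<open>The constant \<open>a\<close> becomes the value at \<open>None\<close>;
          since \<open>a\<close> is 0 for positive \<open>k\<close>, the witness has degree
          \<open>k - 1\<close> in either case.\<close>
        by (rule bexI[of _ "\<lambda>x. case x of None \<Rightarrow> a | Some c \<Rightarrow> \<psi> c"])
          (use psi le Phi(2) in \<open>auto simp: w_add w_d in_A\<close>)
    qed
    show "weight (?d \<Phi>0) \<le> weight (\<lambda>x. \<Phi>0 x + ?d \<Psi> x)"
      if "\<Psi> \<in> cochains ?A (int k - 1)" for \<Psi>
      using that half_strip_sharp[OF kn, of "\<lambda>c. \<Psi> (Some c)" "\<Psi> None"]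
      by (simp add: in_A w_add w_d)
    show "\<Phi>0 \<in> cochains ?A (int k)"
      using half_strip_in_cochains[OF kn] by (simp add: in_A)
    show "0 < weight (?d \<Phi>0)"
      using kn by (simp add: w_d coboundary_half_strip weight_strip_pos)
  qed (rule fin)+
qed

theorem theorem4p3:
  fixes d k :: nat
  assumes "2 \<le> d" and "k \<le> d - 1"
  shows "(1 \<le> k \<longrightarrow> h d k = 1) \<and> reduced_h d k = 1"
proof -
  obtain n where "d = Suc n" using assms(1) by (cases d) auto
  with assms(2) show ?thesis by (simp add: h_eq_1 reduced_h_eq_1)
qed

end
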